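(* Let $n\ge 2$, let $x_1,\dots,x_n\in\mathbb{C}$ with $|x_i|<1$ for all $i$, and let $b_1,\dots,b_n\in\mathbb{C}$ with $\sum_{i=1}^n b_i=1$. Then $$\prod_{\substack{a_1,\dots,a_n\ge 1\\ a_1,\dots,a_{n-1}\le a_n\\ \gcd(a_1,\dots,a_n)=1}}\left(\frac{1}{1-x_1^{a_1}x_2^{a_2}\cdots x_n^{a_n}}\right)^{\frac{1}{a_1^{b_1}a_2^{b_2}\cdots a_n^{b_n}}}=\exp\left\{\sum_{k=1}^{\infty}\prod_{i=1}^{n-1}\left(\sum_{j=1}^{k}\frac{x_i^j}{j^{b_i}}\right)\frac{x_n^k}{k^{b_n}}\right\},$$ where the product runs over all $n$-tuples of positive integers $(a_1,\dots,a_n)$ with $a_i\le a_n$ for $1\le i\le n-1$ and $\gcd(a_1,\dots,a_n)=1$.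
   Context: For a positive integer $j$ and complex $s$, $j^s=e^{s\ln j}$. For $|w|<1$ and complex $e$, $\left(\frac{1}{1-w}\right)^{e}$ means $\exp\left(-e\log(1-w)\right)$ with the principal branch of the logarithm. *)

theory Defs
  imports "HOL-Analysis.Analysis"
begin

text \<open>
  Unordered product over an arbitrary index set, the multiplicative counterpart of
  \<open>has_sum\<close>: the net of finite partial products converges to \<open>p\<close>. The library's \<open>has_prod\<close> only
  covers products indexed by \<open>nat\<close>. As with any product of nonzero factors, convergence in the
  strict sense also asks for \<open>p \<noteq> 0\<close>; this is not built into the definition, but is automatic
  for a value of the form \<open>exp z\<close>.
\<close>

definition has_prod_over ::
    "('a \<Rightarrow> 'b::{comm_monoid_mult, topological_space}) \<Rightarrow> 'b \<Rightarrow> 'a set \<Rightarrow> bool" where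
  "has_prod_over f p A \<longleftrightarrow> ((\<lambda>F. \<Prod>a\<in>F. f a) \<longlongrightarrow> p) (finite_subsets_at_top A)"

text \<open>
  The power \<open>(1 / (1 - w))\<^sup>e\<close> for \<open>|w| < 1\<close>, with the principal branch of the logarithm of \<open>1 - w\<close>.
\<close>

definition geom_powr :: "complex \<Rightarrow> complex \<Rightarrow> complex" where
  "geom_powr w e = exp (- e * Ln (1 - w))"

text \<open>
  An \<open>n\<close>-tuple \<open>(a\<^sub>1, \<dots>, a\<^sub>n)\<close> is a function on \<open>{1..n}\<close>, taken to be extensional so that every
  tuple is represented exactly once.
\<close>

definition visible_tuples :: "nat \<Rightarrow> (nat \<Rightarrow> nat) set" where
  "visible_tuples n =
     {a \<in> {1..n} \<rightarrow>\<^sub>E {1..}. (\<forall>i\<in>{1..n-1}. a i \<le> a n) \<and> Gcd (a ` {1..n}) = 1}"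

end

theory Submission
  imports Defs "HOL-Real_Asymp.Real_Asymp"
begin

text \<open>
  Taking logarithms turns the product into the sum of \<open>w\<^sup>m / m\<close> over all visible tuples \<open>a\<close> and all
  \<open>m \<ge> 1\<close>, with weight \<open>1 / \<Prod>a\<^sub>i\<^bsup>b\<^sub>i\<^esup>\<close> and \<open>w = \<Prod>x\<^sub>i\<^bsup>a\<^sub>i\<^esup>\<close>. Because \<open>\<Sum>b\<^sub>i = 1\<close>, this term
  is exactly \<open>\<Prod>x\<^sub>i\<^bsup>c\<^sub>i\<^esup> / c\<^sub>i\<^bsup>b\<^sub>i\<^esup>\<close> for the tuple \<open>c = m a\<close>. Every tuple whose last entry is
  maximal is a unique multiple of a visible one, so the sum runs over all such tuples; grouping
  them by their last entry \<open>k\<close> gives the series on the right. Everything converges absolutely.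
\<close>

section \<open>Exponentials of sums, the logarithm series and absolute convergence\<close>

lemma has_prod_over_exp:
  fixes f :: "'a \<Rightarrow> 'b :: {real_normed_field, banach}"
  assumes "(f has_sum S) A"
  shows "has_prod_over (\<lambda>a. exp (f a)) (exp S) A"
proof -
  have "((\<lambda>F. exp (sum f F)) \<longlongrightarrow> exp S) (finite_subsets_at_top A)"
    using assms unfolding has_sum_def by (rule tendsto_exp)
  moreover have "\<forall>\<^sub>F F in finite_subsets_at_top A. exp (sum f F) = (\<Prod>a\<in>F. exp (f a))"
    by (rule eventually_finite_subsets_at_top_weakI) (simp add: exp_sum)
  ultimately show ?thesis
    unfolding has_prod_over_def by (rule Lim_transform_eventually)
qed

text \<open>The Taylor series of the logarithm converges absolutely inside the unit disc. The
  unordered form is needed because the series later becomes the inner part of a sum over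
  pairs.\<close>

lemma has_sum_minus_Ln:
  assumes "norm w < 1"
  shows "((\<lambda>m. w ^ Suc m / of_nat (Suc m)) has_sum - Ln (1 - w)) UNIV"
proof (rule norm_summable_imp_has_sum)
  have "(\<lambda>m. - (w ^ m) / of_nat m) sums Ln (1 - w)"
    using Ln_series'[of "- w"] assms by simp
  then have "(\<lambda>m. w ^ m / of_nat m) sums - Ln (1 - w)"
    using sums_minus by fastforce
  \<comment> \<open>The shift of index costs nothing: the term at \<open>m = 0\<close> is
    \<open>1 / 0 = 0\<close>.\<close>
  then show "(\<lambda>m. w ^ Suc m / of_nat (Suc m)) sums - Ln (1 - w)"
    by (subst sums_Suc_iff) simp
  show "summable (\<lambda>m. norm (w ^ Suc m / of_nat (Suc m)))"
  proof (rule summable_comparison_test[OF exI[of _ 0]], safe)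
    show "summable (\<lambda>m. norm w ^ Suc m)"
      using assms by (simp add: summable_geometric summable_mult)
    show "norm (norm (w ^ Suc m / of_nat (Suc m))) \<le> norm w ^ Suc m" for m
      using mult_left_mono[of 1 "real (Suc m)" "norm w ^ Suc m"]
      by (simp add: norm_divide norm_power norm_mult pos_divide_le_eq del: of_nat_Suc power_Suc)
  qed
qed

text \<open>Since \<open>Re s\<close> may be negative, the coefficients can grow, but only
  polynomially. Consecutive ones have ratio tending to 1, so the radius of convergence is still
  1.\<close>

lemma summable_norm_power_divide_powr:
  fixes z s :: complex
  assumes "norm z < 1"
  shows "summable (\<lambda>j. norm (z ^ j / of_nat j powr s))"
\<comment> \<open>Dropping the index 0, where the coefficient is 0 by convention, leaves nonzero
  coefficients, as the ratio test requires. Only \<open>Re s\<close> matters for the norms.\<close>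
proof (subst summable_Suc_iff[symmetric])
  define c where "c = Re s"
  define f where "f m = 1 / real (Suc m) powr c" for m
  have "norm (f m) / norm (f (Suc m)) = real (Suc (Suc m)) powr c / real (Suc m) powr c" for m
    by (simp add: f_def del: of_nat_Suc)
  moreover have "(\<lambda>m. real (Suc (Suc m)) powr c / real (Suc m) powr c) \<longlonglongrightarrow> 1"
    by real_asymp
  ultimately have "(\<lambda>m. norm (f m) / norm (f (Suc m))) \<longlonglongrightarrow> 1"
    by presburger
  then have "conv_radius f = 1"
    by (intro conv_radius_ratio_limit_nonzero[where c = 1]) (simp_all add: one_ereal_def)
  then have "summable (\<lambda>m. norm (f m * norm z ^ m))"
    using assms by (intro abs_summable_in_conv_radius) (simp add: one_ereal_def)
  then have "summable (\<lambda>m. norm z * norm (f m * norm z ^ m))"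
    by (rule summable_mult)
  also have "(\<lambda>m. norm z * norm (f m * norm z ^ m)) =
      (\<lambda>m. norm (z ^ Suc m / of_nat (Suc m) powr s))"
    by (simp add: f_def c_def norm_divide norm_power norm_mult norm_powr_real_powr fun_eq_iff
        abs_mult del: of_nat_Suc)
  finally show "summable (\<lambda>m. norm (z ^ Suc m / of_nat (Suc m) powr s))" .
qed

lemma summable_on_prod_PiE:
  fixes h :: "'i \<Rightarrow> nat \<Rightarrow> complex"
  assumes "finite I" and "\<And>i. i \<in> I \<Longrightarrow> summable (\<lambda>j. norm (h i j))"
  shows "(\<lambda>a. \<Prod>i\<in>I. h i (a i)) summable_on (I \<rightarrow>\<^sub>E UNIV)"
proof -
  have "Infinite_Set_Sum.abs_summable_on (h i) UNIV" if "i \<in> I" for i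
    using assms(2)[OF that] by (simp add: abs_summable_on_nat_iff')
  then have "Infinite_Set_Sum.abs_summable_on (\<lambda>a. \<Prod>i\<in>I. h i (a i)) (I \<rightarrow>\<^sub>E UNIV)"
    using assms(1) by (intro abs_summable_on_prod_PiE) auto
  then show ?thesis
    by (simp add: abs_summable_equivalent[symmetric] abs_summable_summable)
qed

section \<open>Two parametrizations of the tuples whose last entry is maximal\<close>

definition last_max_tuples :: "nat \<Rightarrow> (nat \<Rightarrow> nat) set" where
  "last_max_tuples n = {a \<in> {1..n} \<rightarrow>\<^sub>E {1..}. \<forall>i\<in>{1..n-1}. a i \<le> a n}"

text \<open>Dividing a tuple by its gcd inverts the map. The multiplier is \<open>Suc m\<close>, so
  that \<open>m\<close> ranges over all naturals.\<close>

lemma bij_betw_multiples_of_visible: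
  assumes "n \<ge> 1"
  shows "bij_betw (\<lambda>(a, m). \<lambda>i\<in>{1..n}. Suc m * a i) (visible_tuples n \<times> UNIV) (last_max_tuples n)"
proof -
  have Gcd_scale: "Gcd ((\<lambda>i\<in>{1..n}. c * a i) ` {1..n}) = c * Gcd (a ` {1..n})"
    for c and a :: "nat \<Rightarrow> nat"
  proof -
    have "(\<lambda>i\<in>{1..n}. c * a i) ` {1..n} = (*) c ` (a ` {1..n})"
      by (auto simp: image_image)
    then show ?thesis
      by (simp only: Gcd_mult normalize_nat_def id_apply)
  qed
  define prim where "prim a = (\<lambda>i\<in>{1..n}. a i div Gcd (a ` {1..n}))" for a :: "nat \<Rightarrow> nat"
  have dec: "Gcd (a ` {1..n}) > 0 \<and> prim a \<in> visible_tuples n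
      \<and> (\<lambda>i\<in>{1..n}. Gcd (a ` {1..n}) * prim a i) = a"
    if a: "a \<in> last_max_tuples n" for a
  proof -
    define d where "d = Gcd (a ` {1..n})"
    have dvd: "d dvd a i" if "i \<in> {1..n}" for i
      unfolding d_def using that by (intro Gcd_dvd) auto
    have a_pos: "a i > 0" if "i \<in> {1..n}" for i
      using a that by (force simp: last_max_tuples_def PiE_iff)
    have d_pos: "d > 0"
      using dvd[of n] a_pos[of n] assms by (metis atLeastAtMost_iff dvd_pos_nat order_refl)
    have prim: "prim a i = a i div d" if "i \<in> {1..n}" for i
      unfolding prim_def d_def using that by (rule restrict_apply')
    have eq: "(\<lambda>i\<in>{1..n}. d * prim a i) = a"
    proof
      fix i
      show "(\<lambda>i\<in>{1..n}. d * prim a i) i = a i"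
      proof (cases "i \<in> {1..n}")
        case True
        then show ?thesis by (simp only: restrict_apply' prim dvd dvd_mult_div_cancel)
      next
        case False
        then show ?thesis using a PiE_arb[of a "{1..n}" "\<lambda>_. {1..}" i]
          by (auto simp: last_max_tuples_def)
      qed
    qed
    \<comment> \<open>The gcd is homogeneous: taking it on both sides of \<open>eq\<close> and
      cancelling \<open>d\<close> leaves gcd 1.\<close>
    have "d * Gcd (prim a ` {1..n}) = d"
      using Gcd_scale[of d "prim a"] unfolding eq d_def[symmetric] by (rule sym)
    then have "Gcd (prim a ` {1..n}) = 1"
      using d_pos by simp
    moreover have "prim a \<in> {1..n} \<rightarrow>\<^sub>E {1..}"
    proof -
      have "1 \<le> a i div d" if "i \<in> {1..n}" for i
        using dvd_imp_le[OF dvd[OF that] a_pos[OF that]] d_pos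
        by (simp add: Suc_le_eq div_greater_zero_iff)
      then show ?thesis
        by (intro PiE_I) (simp add: prim, auto simp: prim_def)
    qed
    moreover have "prim a i \<le> prim a n" if "i \<in> {1..n-1}" for i
      
    proof -
      have "i \<in> {1..n}" and "n \<in> {1..n}" using that by auto
      moreover have "a i \<le> a n" using a that by (simp add: last_max_tuples_def)
      ultimately show ?thesis by (simp only: prim div_le_mono)
    qed
    ultimately show ?thesis
      using d_pos eq by (simp add: visible_tuples_def d_def)
  qed
  show ?thesis
  proof (rule bij_betwI')
    fix p q assume p: "p \<in> visible_tuples n \<times> (UNIV :: nat set)"
      and q: "q \<in> visible_tuples n \<times> (UNIV :: nat set)"
    obtain a m where pa: "p = (a, m)" by (cases p)
    obtain a' m' where qa: "q = (a', m')" by (cases q)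
    have *: "(a, m) = (a', m')"
      if eq: "(\<lambda>i\<in>{1..n}. Suc m * a i) = (\<lambda>i\<in>{1..n}. Suc m' * a' i)"
    proof -
      \<comment> \<open>Visible tuples have gcd 1, so the gcds of the two scaled tuples are the
        multipliers themselves.\<close>
      have "Suc m = Suc m'"
        using Gcd_scale[of "Suc m" a] Gcd_scale[of "Suc m'" a'] p q unfolding eq pa qa
        by (simp add: visible_tuples_def)
      moreover have "a i = a' i" for i
      proof (cases "i \<in> {1..n}")
        case True
        then show ?thesis
          using fun_cong[OF eq, of i] \<open>Suc m = Suc m'\<close> by (simp del: mult_Suc)
      next
        case False
        then show ?thesis
          using p q unfolding pa qa by (auto simp: visible_tuples_def PiE_iff extensional_def)
      qed
      ultimately show ?thesis by auto
    qed
    show "((case p of (a, m) \<Rightarrow> \<lambda>i\<in>{1..n}. Suc m * a i) =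
        (case q of (a, m) \<Rightarrow> \<lambda>i\<in>{1..n}. Suc m * a i)) = (p = q)"
      unfolding pa qa prod.case using * by blast
  next
    fix p assume p: "p \<in> visible_tuples n \<times> (UNIV :: nat set)"
    obtain a m where pa: "p = (a, m)" by (cases p)
    have "Suc m * a i \<ge> 1" if "i \<in> {1..n}" for i
      using p that unfolding pa by (force simp: visible_tuples_def PiE_iff)
    moreover have "Suc m * a i \<le> Suc m * a n" if "i \<in> {1..n-1}" for i
      using p that unfolding pa by (intro mult_le_mono2) (auto simp: visible_tuples_def)
    ultimately show "(case p of (a, m) \<Rightarrow> \<lambda>i\<in>{1..n}. Suc m * a i) \<in> last_max_tuples n"
      using assms unfolding pa by (auto simp: last_max_tuples_def simp del: mult_Suc)
  next
    fix a assume "a \<in> last_max_tuples n"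
    from dec[OF this] show "\<exists>p\<in>visible_tuples n \<times> UNIV. a = (case p of (a, m) \<Rightarrow> \<lambda>i\<in>{1..n}. Suc m * a i)"
      \<comment> \<open>The \<open>- 1\<close> undoes the \<open>Suc\<close> in the multiplier; the
        gcd is positive.\<close>
      by (intro bexI[of _ "(prim a, Gcd (a ` {1..n}) - 1)"]) (simp_all del: mult_Suc)
  qed
qed

text \<open>Fixing the last entry as \<open>k = Suc m\<close> leaves the other entries free in
  \<open>{1..k}\<close>, so the fibres are finite boxes, one for each term of the series in the
  exponent.\<close>

lemma bij_betw_last_entry:
  assumes "n \<ge> 1"
  shows "bij_betw (\<lambda>(m, c). c(n := Suc m)) (SIGMA m:UNIV. {1..n-1} \<rightarrow>\<^sub>E {1..Suc m}) (last_max_tuples n)"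
\<comment> \<open>Resetting position \<open>n\<close> to \<open>undefined\<close> makes the
  remaining tuple extensional on \<open>{1..n-1}\<close>. The truncated subtraction is harmless as
  \<open>a n\<close> is positive.\<close>
proof (rule bij_betw_byWitness[where f' = "\<lambda>a. (a n - 1, a(n := undefined))"])
  show "\<forall>p\<in>SIGMA m:UNIV. {1..n-1} \<rightarrow>\<^sub>E {1..Suc m}.
      (\<lambda>a. (a n - 1, a(n := undefined))) ((\<lambda>(m, c). c(n := Suc m)) p) = p"
    using assms by (auto simp: PiE_iff extensional_def fun_eq_iff)
  show "\<forall>a\<in>last_max_tuples n.
      (\<lambda>(m, c). c(n := Suc m)) (a n - 1, a(n := undefined)) = a"
    using assms by (force simp: last_max_tuples_def PiE_iff)
  show "(\<lambda>(m, c). c(n := Suc m)) ` (SIGMA m:UNIV. {1..n-1} \<rightarrow>\<^sub>E {1..Suc m}) \<subseteq> last_max_tuples n"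
    using assms by (fastforce simp: last_max_tuples_def PiE_iff extensional_def)
  show "(\<lambda>a. (a n - 1, a(n := undefined))) ` last_max_tuples n
      \<subseteq> (SIGMA m:UNIV. {1..n-1} \<rightarrow>\<^sub>E {1..Suc m})"
  proof (rule image_subsetI)
    fix a assume a: "a \<in> last_max_tuples n"
    have ge: "1 \<le> a i" if "i \<in> {1..n}" for i
      using a PiE_mem[of a "{1..n}" "\<lambda>_. {1..}" i] that by (simp add: last_max_tuples_def)
    have le: "a i \<le> a n" if "i \<in> {1..n-1}" for i
      using a that by (simp add: last_max_tuples_def)
    have undef: "a i = undefined" if "i \<notin> {1..n}" for i
      using a PiE_arb[of a "{1..n}" "\<lambda>_. {1..}" i] that by (simp add: last_max_tuples_def)
    have "a(n := undefined) \<in> {1..n-1} \<rightarrow>\<^sub>E {1..Suc (a n - 1)}"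
    proof (rule PiE_I)
      fix i assume i: "i \<in> {1..n-1}"
      then have "i \<in> {1..n}" and "i \<noteq> n" using assms by auto
      then show "(a(n := undefined)) i \<in> {1..Suc (a n - 1)}"
        using ge[of i] le[OF i] by simp
    next
      fix i assume "i \<notin> {1..n-1}"
      then have "i = n \<or> i \<notin> {1..n}" by auto
      then show "(a(n := undefined)) i = undefined"
        using undef by auto
    qed
    then show "(a n - 1, a(n := undefined)) \<in> (SIGMA m:UNIV. {1..n-1} \<rightarrow>\<^sub>E {1..Suc m})"
      by simp
  qed
qed

section \<open>Scaling of the summand and comparison of the two sums\<close>

lemma prod_power_divide_powr_scale:
  fixes x b :: "'i \<Rightarrow> complex"
  assumes "finite I" and "(\<Sum>i\<in>I. b i) = 1" and "c > 0"
  shows "(\<Prod>i\<in>I. x i ^ (c * a i) / of_nat (c * a i) powr b i) =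
    1 / (\<Prod>i\<in>I. of_nat (a i) powr b i) * ((\<Prod>i\<in>I. x i ^ a i) ^ c / of_nat c)"
proof -
  \<comment> \<open>Here the condition on the exponents enters: the powers of \<open>c\<close>
    combine to \<open>c\<close> to the power 1.\<close>
  have "(\<Prod>i\<in>I. (of_nat c :: complex) powr b i) = of_nat c"
    using assms by (subst powr_sum[symmetric]) auto
  then have "(\<Prod>i\<in>I. (of_nat (c * a i) :: complex) powr b i) =
      of_nat c * (\<Prod>i\<in>I. of_nat (a i) powr b i)"
    \<comment> \<open>The bases are nonnegative reals, so \<open>powr\<close> is multiplicative with
      no branch correction.\<close>
    by (simp add: powr_times_real prod.distrib)
  moreover have "(\<Prod>i\<in>I. x i ^ (c * a i)) = (\<Prod>i\<in>I. x i ^ a i) ^ c"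
    by (simp add: power_mult mult.commute[of c] prod_power_distrib)
  ultimately show ?thesis
    by (simp add: prod_dividef)
qed

theorem theorem5p1:
  fixes n :: nat and x b :: "nat \<Rightarrow> complex"
  assumes "n \<ge> 2"
    and "\<And>i. i \<in> {1..n} \<Longrightarrow> norm (x i) < 1"
    and "(\<Sum>i=1..n. b i) = 1"
  shows "\<exists>S. (\<lambda>m. let k = Suc m in
                 (\<Prod>i=1..n-1. \<Sum>j=1..k. x i ^ j / of_nat j powr b i)
                   * (x n ^ k / of_nat k powr b n)) sums S
           \<and> has_prod_over
               (\<lambda>a. geom_powr (\<Prod>i=1..n. x i ^ a i) (1 / (\<Prod>i=1..n. of_nat (a i) powr b i)))
               (exp S) (visible_tuples n)"
proof -
  have n: "n \<ge> 1" and I: "{1..n} = insert n {1..n-1}" and "n \<notin> {1..n-1}"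
    using assms(1) by auto
  define h where "h i j = x i ^ j / of_nat j powr b i" for i j
  define g where "g a = (\<Prod>i=1..n. h i (a i))" for a
  define S where "S = infsum g (last_max_tuples n)"
  define e where "e a = 1 / (\<Prod>i=1..n. of_nat (a i) powr b i)" for a :: "nat \<Rightarrow> nat"
  define w where "w a = (\<Prod>i=1..n. x i ^ a i)" for a

  \<comment> \<open>On the full product set, entries 0 included, the summand is a product of
    absolutely summable one-variable families; summability then restricts to the subset of
    interest.\<close>
  have "g summable_on ({1..n} \<rightarrow>\<^sub>E UNIV)"
    unfolding g_def h_def using assms(2)
    by (intro summable_on_prod_PiE summable_norm_power_divide_powr) auto
  then have "g summable_on last_max_tuples n"
    by (rule summable_on_subset_banach)
      (use PiE_mono[of "{1..n}" "\<lambda>_. {1..}" "\<lambda>_. UNIV"] in \<open>auto simp: last_max_tuples_def\<close>)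
  then have S: "(g has_sum S) (last_max_tuples n)"
    unfolding S_def by (rule has_sum_infsum)

  \<comment> \<open>First evaluation of \<open>S\<close>: sum over the free entries first, then over
    the last entry.\<close>
  have "((\<lambda>p. g (case p of (m, c) \<Rightarrow> c(n := Suc m))) has_sum S)
      (SIGMA m:UNIV. {1..n-1} \<rightarrow>\<^sub>E {1..Suc m})"
    using S has_sum_reindex_bij_betw[OF bij_betw_last_entry[OF n]] by blast
  then have "((\<lambda>m. (\<Prod>i=1..n-1. \<Sum>j=1..Suc m. h i j) * h n (Suc m)) has_sum S) UNIV"
  proof (rule has_sum_SigmaD)
    fix m
    have "g (c(n := Suc m)) = (\<Prod>i=1..n-1. h i (c i)) * h n (Suc m)" for c
    proof -
      have "(\<Prod>i=1..n-1. h i ((c(n := Suc m)) i)) = (\<Prod>i=1..n-1. h i (c i))"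
        using \<open>n \<notin> {1..n-1}\<close> by (intro prod.cong) auto
      then show ?thesis
        unfolding g_def I using \<open>n \<notin> {1..n-1}\<close> by (simp del: fun_upd_apply add: fun_upd_same mult.commute)
    qed
    \<comment> \<open>Distributivity: expanding the product of finite sums chooses one
      \<open>c i\<close> for each \<open>i\<close>.\<close>
    then have "(\<Prod>i=1..n-1. \<Sum>j=1..Suc m. h i j) * h n (Suc m) =
        (\<Sum>c\<in>{1..n-1} \<rightarrow>\<^sub>E {1..Suc m}. g (c(n := Suc m)))"
      by (simp only: prod_sum_PiE finite_atLeastAtMost sum_distrib_right)
    moreover have "finite ({1..n-1} \<rightarrow>\<^sub>E {1..Suc m})"
      by (intro finite_PiE) auto
    ultimately show "((\<lambda>c. g (case (m, c) of (m, c) \<Rightarrow> c(n := Suc m))) has_sum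
        (\<Prod>i=1..n-1. \<Sum>j=1..Suc m. h i j) * h n (Suc m)) ({1..n-1} \<rightarrow>\<^sub>E {1..Suc m})"
      by (simp only: prod.case has_sum_finite)
  qed
  then have sums: "(\<lambda>m. (\<Prod>i=1..n-1. \<Sum>j=1..Suc m. h i j) * h n (Suc m)) sums S"
    by (rule has_sum_imp_sums)

  \<comment> \<open>Second evaluation of \<open>S\<close>: sum over the multiples of each visible
    tuple first, which gives a logarithm series.\<close>
  have "((\<lambda>p. g (case p of (a, m) \<Rightarrow> \<lambda>i\<in>{1..n}. Suc m * a i)) has_sum S)
      (visible_tuples n \<times> UNIV)"
    using S has_sum_reindex_bij_betw[OF bij_betw_multiples_of_visible[OF n]] by blast
  then have "((\<lambda>a. - e a * Ln (1 - w a)) has_sum S) (visible_tuples n)"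
  proof (rule has_sum_SigmaD)
    fix a assume a: "a \<in> visible_tuples n"
    have "norm (x i ^ a i) < 1" if "i \<in> {1..n}" for i
    proof -
      have "a i \<noteq> 0" using a that by (force simp: visible_tuples_def PiE_iff)
      then show ?thesis using assms(2)[OF that] by (simp add: norm_power power_less_one_iff)
    qed
    \<comment> \<open>All factors have norm below 1 because the exponents \<open>a i\<close> are
      positive, and there is at least one factor; this puts \<open>w a\<close> in the disc where the
      logarithm series converges.\<close>
    then have "norm (w a) < (\<Prod>i=1..n. 1)"
      unfolding w_def prod_norm[symmetric] using n
      by (intro prod_mono_strict[of n]) (auto intro: less_imp_le)
    then have "((\<lambda>m. e a * (w a ^ Suc m / of_nat (Suc m))) has_sum e a * - Ln (1 - w a)) UNIV"
      by (intro has_sum_cmult_right has_sum_minus_Ln) simp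
    moreover have "g (\<lambda>i\<in>{1..n}. Suc m * a i) = e a * (w a ^ Suc m / of_nat (Suc m))" for m
      using prod_power_divide_powr_scale[of "{1..n}" b "Suc m" x a] assms(3)
      by (simp add: g_def h_def e_def w_def del: mult_Suc of_nat_mult of_nat_Suc power_Suc)
    ultimately show "((\<lambda>m. g (case (a, m) of (a, m) \<Rightarrow> \<lambda>i\<in>{1..n}. Suc m * a i)) has_sum
        - e a * Ln (1 - w a)) UNIV"
      by simp
  qed
  \<comment> \<open>Exponentiating turns the finite partial sums into partial products, and
    continuity of \<open>exp\<close> passes to the limit.\<close>
  then have "has_prod_over (\<lambda>a. geom_powr (w a) (e a)) (exp S) (visible_tuples n)"
    unfolding geom_powr_def by (rule has_prod_over_exp)
  then show ?thesis
    using sums unfolding h_def e_def w_def Let_def by blast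
qed

end
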